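(* Pick $i\in\{1,2,3\}$ and consider the $\mathfrak{sl}_2(\mathbb C)$-module structure on $P=\mathbb C[x,y,z,w]$ on which $E,F,H$ act as $-L_i$, $R_i$, $-\Omega-2I$ respectively. For $N\in\mathbb N$ the following are the same: (i) the span of the irreducible $\mathfrak{sl}_2(\mathbb C)$-submodules of $P$ that have highest-weight $-N-2$; (ii) $\sum_{\ell\in\mathbb N}R_i^\ell\bigl({\rm Ker}(L_i)\cap P_N\bigr)$; (iii) the eigenspace of $C_i$ on $P$ with eigenvalue $N(N+2)/2$.
   Context: $\mathbb N=\{0,1,2,\ldots\}$. $\mathfrak{sl}_2(\mathbb C)$ has basis $E,F,H$ with $[H,E]=2E$, $[H,F]=-2F$, $[E,F]=H$. $P_N$ is the subspace of $P$ of homogeneous polynomials of total degree $N$. With $D_x,D_y,D_z,D_w$ the partial derivatives, define $L_i,R_i\in{\rm End}(P)$ by $L_1=D_xD_y-D_zD_w$, $L_2=D_xD_z-D_wD_y$, $L_3=D_xD_w-D_yD_z$; $R_1(f)=(xy-zw)f$, $R_2(f)=(xz-wy)f$, $R_3(f)=(xw-yz)f$. $\Omega\in{\rm End}(P)$ acts on each $P_N$ as $N$ times the identity $I$. $C_i=\frac{(\Omega+2I)^2}2-L_iR_i-R_iL_i\in{\rm End}(P)$. An $\mathfrak{sl}_2(\mathbb C)$-module $W$ is highest-weight if it contains a nonzero $v$ that is an eigenvector of $H$, satisfies $Ev=0$, and for which $W$ is spanned by $\{F^\ell v\}_{\ell\in\mathbb N}$; such $v$ is unique up to a nonzero scalar,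 and the highest-weight of $W$ is the $H$-eigenvalue of $v$. Every irreducible $\mathfrak{sl}_2(\mathbb C)$-submodule of $P$ is highest-weight. *)

theory Defs
  imports "HOL-Analysis.Determinants" "HOL-Library.Poly_Mapping"
begin

section \<open>The polynomial algebra \<open>P = \<complex>[x,y,z,w]\<close>\<close>

datatype pvar = VX | VY | VZ | VW

type_synonym mon = "pvar \<Rightarrow>\<^sub>0 nat"

type_synonym P = "mon \<Rightarrow>\<^sub>0 complex"

definition cscale :: "complex \<Rightarrow> P \<Rightarrow> P" where
  "cscale c f = Poly_Mapping.map ((*) c) f"

lemma lookup_cscale [simp]: "Poly_Mapping.lookup (cscale c f) m = c * Poly_Mapping.lookup f m"
  by (auto simp: cscale_def Poly_Mapping.map.rep_eq when_def)

interpretation P: vector_space cscale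
  by unfold_locales (auto intro!: poly_mapping_eqI simp: lookup_add algebra_simps)

definition var :: "pvar \<Rightarrow> P" where
  "var v = Poly_Mapping.single (Poly_Mapping.single v 1) 1"

definition tdeg :: "mon \<Rightarrow> nat" where
  "tdeg m = Poly_Mapping.lookup m VX + Poly_Mapping.lookup m VY + Poly_Mapping.lookup m VZ + Poly_Mapping.lookup m VW"

definition homog :: "nat \<Rightarrow> P set" where
  "homog N = {f. \<forall>m\<in>Poly_Mapping.keys f. tdeg m = N}"

text \<open>In \<open>pd\<close> the subtraction of exponents is truncated, but a monomial not containing \<open>v\<close>
  gets the coefficient \<open>0\<close>.\<close>

definition pd :: "pvar \<Rightarrow> P \<Rightarrow> P" where
  "pd v f = (\<Sum>m\<in>Poly_Mapping.keys f. Poly_Mapping.single (m - Poly_Mapping.single v 1)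
                             (of_nat (Poly_Mapping.lookup m v) * Poly_Mapping.lookup f m))"

definition Omega :: "P \<Rightarrow> P" where
  "Omega f = (\<Sum>m\<in>Poly_Mapping.keys f. Poly_Mapping.single m (of_nat (tdeg m) * Poly_Mapping.lookup f m))"


section \<open>The operators \<open>L\<^sub>i\<close>, \<open>R\<^sub>i\<close>, \<open>C\<^sub>i\<close>\<close>

text \<open>Only the indices \<open>1\<close>, \<open>2\<close>, \<open>3\<close> are meaningful.\<close>

definition L :: "nat \<Rightarrow> P \<Rightarrow> P" where
  "L i f =
    (if i = 1 then pd VX (pd VY f) - pd VZ (pd VW f)
     else if i = 2 then pd VX (pd VZ f) - pd VW (pd VY f)
     else if i = 3 then pd VX (pd VW f) - pd VY (pd VZ f)
     else 0)"

definition R :: "nat \<Rightarrow> P \<Rightarrow> P" where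
  "R i f =
    (if i = 1 then (var VX * var VY - var VZ * var VW) * f
     else if i = 2 then (var VX * var VZ - var VW * var VY) * f
     else if i = 3 then (var VX * var VW - var VY * var VZ) * f
     else 0)"

definition Omega2 :: "P \<Rightarrow> P" where
  "Omega2 f = Omega f + cscale 2 f"

definition C :: "nat \<Rightarrow> P \<Rightarrow> P" where
  "C i f = cscale (1/2) (Omega2 (Omega2 f)) - L i (R i f) - R i (L i f)"


section \<open>Representations of \<open>\<ss>\<ll>\<^sub>2(\<complex>)\<close> on \<open>P\<close>\<close>

definition sl2 :: "(complex^2^2) set" where
  "sl2 = {A. trace A = 0}"

definition bracket :: "complex^2^2 \<Rightarrow> complex^2^2 \<Rightarrow> complex^2^2" where
  "bracket A B = A ** B - B ** A"

definition matE :: "complex^2^2" where "matE = vector [vector [0, 1], vector [0, 0]]"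
definition matF :: "complex^2^2" where "matF = vector [vector [0, 0], vector [1, 0]]"
definition matH :: "complex^2^2" where "matH = vector [vector [1, 0], vector [0, -1]]"

text \<open>The scalar multiple \<open>c A\<close> of a matrix is written \<open>\<chi> j. c *s A $ j\<close>. Values of \<open>\<rho>\<close> outside
  \<open>sl2\<close> are irrelevant.\<close>

definition sl2_module :: "(complex^2^2 \<Rightarrow> P \<Rightarrow> P) \<Rightarrow> bool" where
  "sl2_module \<rho> \<longleftrightarrow>
     (\<forall>A\<in>sl2. Vector_Spaces.linear cscale cscale (\<rho> A)) \<and>
     (\<forall>A\<in>sl2. \<forall>B\<in>sl2. \<forall>f. \<rho> (A + B) f = \<rho> A f + \<rho> B f) \<and>
     (\<forall>c. \<forall>A\<in>sl2. \<forall>f. \<rho> (\<chi> j. c *s A $ j) f = cscale c (\<rho> A f)) \<and>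
     (\<forall>A\<in>sl2. \<forall>B\<in>sl2. \<forall>f. \<rho> (bracket A B) f = \<rho> A (\<rho> B f) - \<rho> B (\<rho> A f))"

definition submodule :: "(complex^2^2 \<Rightarrow> P \<Rightarrow> P) \<Rightarrow> P set \<Rightarrow> bool" where
  "submodule \<rho> W \<longleftrightarrow> P.subspace W \<and> (\<forall>A\<in>sl2. \<forall>f\<in>W. \<rho> A f \<in> W)"

definition irreducible_submodule :: "(complex^2^2 \<Rightarrow> P \<Rightarrow> P) \<Rightarrow> P set \<Rightarrow> bool" where
  "irreducible_submodule \<rho> W \<longleftrightarrow>
     submodule \<rho> W \<and> W \<noteq> {0} \<and> (\<forall>U. submodule \<rho> U \<and> U \<subseteq> W \<longrightarrow> U = {0} \<or> U = W)"

definition has_highest_weight :: "(complex^2^2 \<Rightarrow> P \<Rightarrow> P) \<Rightarrow> P set \<Rightarrow> complex \<Rightarrow> bool" where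
  "has_highest_weight \<rho> W \<mu> \<longleftrightarrow>
     (\<exists>v\<in>W. v \<noteq> 0 \<and> \<rho> matH v = cscale \<mu> v \<and> \<rho> matE v = 0 \<and>
        W = P.span (range (\<lambda>l. (\<rho> matF ^^ l) v)))"

definition sum_of_subspaces :: "(nat \<Rightarrow> P set) \<Rightarrow> P set" where
  "sum_of_subspaces U = {(\<Sum>l\<in>S. g l) | S g. finite S \<and> (\<forall>l\<in>S. g l \<in> U l)}"

definition eigenspace :: "(P \<Rightarrow> P) \<Rightarrow> complex \<Rightarrow> P set" where
  "eigenspace T c = {f. T f = cscale c f}"


section \<open>The operators behave as intended\<close>

lemma lookup_pd:
  "Poly_Mapping.lookup (pd v f) m = of_nat (Poly_Mapping.lookup m v + 1) * Poly_Mapping.lookup f (m + Poly_Mapping.single v 1)"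
proof -
  let ?e = "Poly_Mapping.single v (1::nat)"
  have eq: "Poly_Mapping.lookup (Poly_Mapping.single (k - ?e) (of_nat (Poly_Mapping.lookup k v) * Poly_Mapping.lookup f k)) m
      = (if k = m + ?e then of_nat (Poly_Mapping.lookup m v + 1) * Poly_Mapping.lookup f (m + ?e) else 0)" for k
  proof (cases "k = m + ?e")
    case False
    have "k = m + ?e" if "k - ?e = m" "Poly_Mapping.lookup k v \<noteq> 0"
      using that by (intro poly_mapping_eqI)
        (auto simp: lookup_add lookup_minus lookup_single when_def)
    with False show ?thesis by (auto simp: lookup_single when_def)
  qed (simp add: lookup_add)
  show ?thesis
    unfolding pd_def lookup_sum eq by (auto simp: in_keys_iff)
qed

lemma lookup_Omega: "Poly_Mapping.lookup (Omega f) m = of_nat (tdeg m) * Poly_Mapping.lookup f m"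
  unfolding Omega_def lookup_sum
  by (simp add: lookup_single when_def in_keys_iff)

lemma Omega_homog:
  assumes "f \<in> homog N"
  shows "Omega f = cscale (of_nat N) f"
proof (rule poly_mapping_eqI)
  fix m
  show "Poly_Mapping.lookup (Omega f) m = Poly_Mapping.lookup (cscale (of_nat N) f) m"
    using assms by (cases "m \<in> Poly_Mapping.keys f") (auto simp: homog_def lookup_Omega in_keys_iff)
qed

lemma linear_pd: "Vector_Spaces.linear cscale cscale (pd v)"
  by unfold_locales
    (auto intro!: poly_mapping_eqI simp: lookup_pd lookup_add algebra_simps)

lemma linear_Omega: "Vector_Spaces.linear cscale cscale Omega"
  by unfold_locales
    (auto intro!: poly_mapping_eqI simp: lookup_Omega lookup_add algebra_simps)

lemma pd_simps [simp]:
  "pd v (f + g) = pd v f + pd v g" "pd v (f - g) = pd v f - pd v g"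
  "pd v (- f) = - pd v f" "pd v 0 = 0" "pd v (cscale c f) = cscale c (pd v f)"
  by (auto intro!: poly_mapping_eqI simp: lookup_pd lookup_add lookup_minus algebra_simps)

lemma pd_commute: "pd u (pd v f) = pd v (pd u f)"
  by (cases "u = v")
    (auto intro!: poly_mapping_eqI simp: lookup_pd lookup_add lookup_single when_def ac_simps)

lemma P_induct [case_names monomial add]:
  fixes f :: P
  assumes "\<And>m c. Q (Poly_Mapping.single m c)" "\<And>f g. Q f \<Longrightarrow> Q g \<Longrightarrow> Q (f + g)"
  shows "Q f"
proof (induction f rule: update_induct)
  case const
  show ?case using assms(1)[of 0 0] by simp
next
  case (update f k b)
  have "Poly_Mapping.update k b f = f + Poly_Mapping.single k b"
    using update.hyps by (intro poly_mapping_eqI)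
      (auto simp: lookup_update lookup_add lookup_single when_def in_keys_iff)
  then show ?case using assms update by metis
qed

lemma pd_single:
  "pd v (Poly_Mapping.single m c)
     = Poly_Mapping.single (m - Poly_Mapping.single v 1) (of_nat (Poly_Mapping.lookup m v) * c)"
  by (cases "c = 0") (simp_all add: pd_def)

lemma cscale_eq_mult: "cscale c f = Poly_Mapping.single 0 c * f"
proof (induction f rule: P_induct)
  case (monomial m d)
  show ?case by (auto intro!: poly_mapping_eqI simp: mult_single lookup_single when_def)
next
  case (add f g)
  then show ?case by (simp add: P.scale_right_distrib algebra_simps)
qed

lemma pd_var_mult [simp]:
  "pd v (var u * f) = (if u = v then f else 0) + var u * pd v f"
proof (induction f rule: P_induct)
  case (monomial m c)
  show ?case
  proof (cases "Poly_Mapping.lookup m v = 0")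
    case False
    then have shift: "Poly_Mapping.single u 1 + (m - Poly_Mapping.single v (1::nat))
        = Poly_Mapping.single u 1 + m - Poly_Mapping.single v 1"
      by (intro poly_mapping_eqI) (auto simp: lookup_add lookup_minus lookup_single when_def)
    show ?thesis
      unfolding var_def mult_single pd_single shift
      by (auto simp: lookup_add lookup_single when_def distrib_right simp flip: single_add)
  qed (auto simp: var_def mult_single pd_single lookup_add lookup_single when_def)
next
  case (add f g)
  then show ?case by (simp add: algebra_simps)
qed

lemma Omega_simps [simp]:
  "Omega (f + g) = Omega f + Omega g" "Omega (f - g) = Omega f - Omega g"
  "Omega (- f) = - Omega f" "Omega 0 = 0" "Omega (cscale c f) = cscale c (Omega f)"
  by (auto intro!: poly_mapping_eqI simp: lookup_Omega lookup_add lookup_minus algebra_simps)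

lemma Omega_Euler:
  "Omega f = var VX * pd VX f + var VY * pd VY f + var VZ * pd VZ f + var VW * pd VW f"
proof (induction f rule: P_induct)
  case (monomial m c)
  have one: "var v * pd v (Poly_Mapping.single m c)
      = Poly_Mapping.single m (of_nat (Poly_Mapping.lookup m v) * c)" for v
  proof (cases "Poly_Mapping.lookup m v = 0")
    case False
    then have "Poly_Mapping.single v 1 + (m - Poly_Mapping.single v (1::nat)) = m"
      by (intro poly_mapping_eqI) (auto simp: lookup_add lookup_minus lookup_single when_def)
    then show ?thesis by (simp add: var_def pd_single mult_single)
  qed (simp add: pd_single)
  have "Omega (Poly_Mapping.single m c) = Poly_Mapping.single m (of_nat (tdeg m) * c)"
    by (auto intro!: poly_mapping_eqI simp: lookup_Omega lookup_single when_def)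
  then show ?case
    unfolding one by (simp add: tdeg_def algebra_simps flip: single_add)
next
  case (add f g)
  then show ?case by (simp add: algebra_simps)
qed

lemma L_simps [simp]:
  "L i (f + g) = L i f + L i g" "L i (f - g) = L i f - L i g"
  "L i (- f) = - L i f" "L i (cscale c f) = cscale c (L i f)"
  by (auto simp: L_def P.scale_right_diff_distrib)

lemma R_simps [simp]:
  "R i (f + g) = R i f + R i g" "R i (f - g) = R i f - R i g"
  "R i (- f) = - R i f" "R i (cscale c f) = cscale c (R i f)"
  by (auto simp: R_def algebra_simps cscale_eq_mult)

lemma cscale_2: "cscale 2 f = f + f"
  by (rule poly_mapping_eqI) (simp only: lookup_cscale lookup_add mult_2)

lemma comm_LR:
  assumes "i \<in> {1, 2, 3}"
  shows "L i (R i f) - R i (L i f) = Omega f + cscale 2 f"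
proof -
  have R: "R (Suc 0) f = var VX * (var VY * f) - var VZ * (var VW * f)"
    "R 2 f = var VX * (var VZ * f) - var VW * (var VY * f)"
    "R 3 f = var VX * (var VW * f) - var VY * (var VZ * f)" for f
    by (simp_all add: R_def left_diff_distrib mult.assoc)
  consider "i = 1" | "i = 2" | "i = 3" using assms by blast
  then show ?thesis
    by cases (simp_all add: L_def R Omega_Euler cscale_2 distrib_left right_diff_distrib
      pd_commute[of VY VX] pd_commute[of VZ VX] pd_commute[of VW VX]
      pd_commute[of VZ VY] pd_commute[of VW VY] pd_commute[of VW VZ])
qed

lemma comm_OL: "Omega (L i f) - L i (Omega f) = - cscale 2 (L i f)"
  by (rule poly_mapping_eqI)
    (auto simp: L_def lookup_Omega lookup_pd lookup_minus tdeg_def lookup_add lookup_single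
      when_def algebra_simps)

lemma comm_OR: "Omega (R i f) - R i (Omega f) = cscale 2 (R i f)"
proof -
  have *: "Omega (var u * f) = var u * Omega f + var u * f" for u f
    by (cases u) (simp_all add: Omega_Euler distrib_left mult.left_commute)
  show ?thesis
    by (auto simp: R_def left_diff_distrib distrib_left mult.assoc * cscale_2)
qed

lemma sl2_module_exists:
  assumes "i \<in> {1, 2, 3}"
  shows "\<exists>\<rho>. sl2_module \<rho> \<and> \<rho> matE = (\<lambda>f. - L i f) \<and> \<rho> matF = R i \<and>
           \<rho> matH = (\<lambda>f. - Omega f - cscale 2 f)"
proof -
  define \<rho> :: "complex^2^2 \<Rightarrow> P \<Rightarrow> P" where
    "\<rho> A f = cscale (A$1$2) (- L i f) + cscale (A$2$1) (R i f)
             + cscale (A$1$1) (- Omega f - cscale 2 f)" for A f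
  have tr: "A$2$2 = - A$1$1" if "A \<in> sl2" for A
    using that by (simp add: sl2_def trace_def sum_2 add_eq_0_iff)
  have LR: "L i (R i f) = R i (L i f) + Omega f + cscale 2 f" for f
    using comm_LR[OF assms, of f] by (simp add: algebra_simps)
  have OL: "Omega (L i f) = L i (Omega f) - cscale 2 (L i f)" for f
    using comm_OL[of i f] by (simp add: algebra_simps)
  have OR: "Omega (R i f) = R i (Omega f) + cscale 2 (R i f)" for f
    using comm_OR[of i f] by (simp add: algebra_simps)
  have lin: "Vector_Spaces.linear cscale cscale (\<rho> A)" for A
    by unfold_locales (simp_all add: \<rho>_def, (rule poly_mapping_eqI,
        simp add: lookup_add lookup_minus algebra_simps)+)
  have add: "\<rho> (A + B) f = \<rho> A f + \<rho> B f" for A B f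
    by (rule poly_mapping_eqI) (simp add: \<rho>_def lookup_add lookup_minus algebra_simps)
  have scale: "\<rho> (\<chi> j. c *s A $ j) f = cscale c (\<rho> A f)" for c A f
    by (rule poly_mapping_eqI) (simp add: \<rho>_def lookup_add lookup_minus algebra_simps)
  have br: "\<rho> (bracket A B) f = \<rho> A (\<rho> B f) - \<rho> B (\<rho> A f)"
    if "A \<in> sl2" "B \<in> sl2" for A B f
  proof (rule poly_mapping_eqI)
    have entries: "bracket A B $ 1 $ 1 = A$1$2 * B$2$1 - B$1$2 * A$2$1"
      "bracket A B $ 1 $ 2 = 2 * (A$1$1 * B$1$2 - B$1$1 * A$1$2)"
      "bracket A B $ 2 $ 1 = 2 * (A$2$1 * B$1$1 - B$2$1 * A$1$1)"
      by (simp_all add: bracket_def matrix_matrix_mult_def sum_2 tr[OF that(1)] tr[OF that(2)]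
          algebra_simps)
    fix m
    show "Poly_Mapping.lookup (\<rho> (bracket A B) f) m
        = Poly_Mapping.lookup (\<rho> A (\<rho> B f) - \<rho> B (\<rho> A f)) m"
      unfolding \<rho>_def entries
      by (simp only: L_simps R_simps Omega_simps LR OL OR lookup_cscale lookup_add lookup_minus
          lookup_uminus) (simp add: algebra_simps)
  qed
  have "sl2_module \<rho>"
    using lin add scale br by (simp add: sl2_module_def)
  moreover have "\<rho> matE = (\<lambda>f. - L i f)" "\<rho> matF = R i"
    "\<rho> matH = (\<lambda>f. - Omega f - cscale 2 f)"
    by (auto simp: fun_eq_iff \<rho>_def matE_def matF_def matH_def)
  ultimately show ?thesis by blast
qed

end

theory Submission
  imports Defs
begin

text \<open>Write \<open>K\<^sub>N\<close> for \<open>Ker L\<^sub>i \<inter> P\<^sub>N\<close> and \<open>c\<^sub>N = N(N+2)/2\<close>. On \<open>P\<^sub>M\<close> the operator \<open>C\<^sub>i\<close> equals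
  \<open>c\<^sub>M I - 2 R\<^sub>i L\<^sub>i\<close>, and \<open>C\<^sub>i\<close> commutes with \<open>L\<^sub>i\<close> and \<open>R\<^sub>i\<close>; so it acts as \<open>c\<^sub>N\<close> on every \<open>R\<^sub>i\<^sup>l K\<^sub>N\<close>.
  Conversely let \<open>f \<in> P\<^sub>M\<close> satisfy \<open>C\<^sub>i f = c\<^sub>N f\<close>. Then \<open>L\<^sub>i f\<close> satisfies the same equation in degree
  \<open>M - 2\<close>, and induction on \<open>M\<close> gives \<open>f = 0\<close> for \<open>M < N\<close>, \<open>f \<in> K\<^sub>N\<close> for \<open>M = N\<close>, and for \<open>M > N\<close> that
  \<open>f\<close> is a multiple of \<open>R\<^sub>i L\<^sub>i f\<close>. As \<open>C\<^sub>i\<close> preserves degrees, this determines its eigenspace.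
  The irreducible submodules in question are exactly the spans of the strings \<open>v, R\<^sub>i v, R\<^sub>i\<^sup>2 v, \<dots>\<close> with
  \<open>0 \<noteq> v \<in> K\<^sub>N\<close>: applying a power of \<open>L\<^sub>i\<close> to a nonzero element of such a span recovers a nonzero
  multiple of \<open>v\<close>.\<close>

section \<open>Homogeneous polynomials\<close>

text \<open>This turns degree claims into eigenvalue claims, so that \<open>comm_OL\<close> and
  \<open>comm_OR\<close> show how \<open>L\<close> and \<open>R\<close> shift degrees.\<close>

lemma homog_iff_Omega: "f \<in> homog M \<longleftrightarrow> Omega f = cscale (of_nat M) f"
proof
  assume eq: "Omega f = cscale (of_nat M) f"
  show "f \<in> homog M"
    unfolding homog_def
  proof safe
    fix m assume "m \<in> Poly_Mapping.keys f"
    moreover have "of_nat (tdeg m) * Poly_Mapping.lookup f m = of_nat M * Poly_Mapping.lookup f m"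
      using arg_cong[OF eq, of "\<lambda>g. Poly_Mapping.lookup g m"] by (simp add: lookup_Omega)
    ultimately show "tdeg m = M"
      by (simp add: in_keys_iff)
  qed
qed (rule Omega_homog)

lemma subspace_homog: "P.subspace (homog M)"
  by (rule P.subspaceI) (simp_all add: homog_iff_Omega P.scale_right_distrib P.scale_left_commute)

lemma L_zero [simp]: "L i 0 = 0"
  using L_simps(4)[of i 0 0] by simp

lemma R_zero [simp]: "R i 0 = 0"
  using R_simps(4)[of i 0 0] by simp

lemma Omega_L:
  assumes "f \<in> homog M"
  shows "Omega (L i f) = cscale (of_nat M - 2) (L i f)"
  using comm_OL[of i f] by (simp add: Omega_homog[OF assms] P.scale_left_diff_distrib algebra_simps)

text \<open>By \<open>Omega_L\<close>, \<open>Omega\<close> scales \<open>L i f\<close> by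
  \<open>M - 2\<close>, which is negative here, while it scales each coefficient by a natural number
  \<open>tdeg m\<close>.\<close>

lemma L_eq_0:
  assumes "f \<in> homog M" "M < 2"
  shows "L i f = 0"
proof (rule poly_mapping_eqI)
  fix m
  have "of_nat (tdeg m) * Poly_Mapping.lookup (L i f) m
      = (of_nat M - 2) * Poly_Mapping.lookup (L i f) m"
    using arg_cong[OF Omega_L[OF assms(1), of i], of "\<lambda>g. Poly_Mapping.lookup g m"]
    by (simp add: lookup_Omega)
  moreover have "of_nat (tdeg m) \<noteq> (of_nat M - 2 :: complex)"
  proof
    assume "of_nat (tdeg m) = (of_nat M - 2 :: complex)"
    then have "of_nat (tdeg m + 2) = (of_nat M :: complex)"
      by simp
    then show False
      using assms(2) unfolding of_nat_eq_iff by simp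
  qed
  ultimately show "Poly_Mapping.lookup (L i f) m = Poly_Mapping.lookup 0 m"
    by simp
qed

text \<open>The truncated \<open>M - 2\<close> is harmless: for \<open>M < 2\<close> the image is 0,
  which lies in every \<open>homog\<close>.\<close>

lemma L_homog:
  assumes "f \<in> homog M"
  shows "L i f \<in> homog (M - 2)"
proof (cases "M < 2")
  case True
  then show ?thesis using L_eq_0[OF assms] by (simp add: homog_def)
next
  case False
  then show ?thesis using Omega_L[OF assms, of i] by (simp add: homog_iff_Omega of_nat_diff)
qed

lemma R_homog:
  assumes "f \<in> homog M"
  shows "R i f \<in> homog (M + 2)"
  using comm_OR[of i f]
  by (simp add: homog_iff_Omega Omega_homog[OF assms] P.scale_left_distrib algebra_simps)

lemma R_funpow_homog: "f \<in> homog M \<Longrightarrow> (R i ^^ l) f \<in> homog (M + 2 * l)"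
  by (induction l) (use R_homog in fastforce)+

lemma homog_decomposition:
  obtains F n where "f = (\<Sum>M<n. F M)" "\<And>M. F M \<in> homog M"
proof
  define F where "F M = (\<Sum>m\<in>{m \<in> Poly_Mapping.keys f. tdeg m = M}.
    Poly_Mapping.single m (Poly_Mapping.lookup f m))" for M
  \<comment> \<open>Inserting 0 keeps \<open>Max\<close> defined when \<open>f = 0\<close>.\<close>
  define n where "n = Suc (Max (insert 0 (tdeg ` Poly_Mapping.keys f)))"
  have n: "tdeg m < n" if "m \<in> Poly_Mapping.keys f" for m
    using that by (simp add: n_def le_imp_less_Suc)
  have F: "Poly_Mapping.lookup (F M) m = (if tdeg m = M then Poly_Mapping.lookup f m else 0)" for M m
    by (auto simp: F_def lookup_sum lookup_single when_def in_keys_iff)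
  show "F M \<in> homog M" for M
    by (auto simp: homog_def in_keys_iff F split: if_splits)
  show "f = (\<Sum>M<n. F M)"
    using n by (intro poly_mapping_eqI) (auto simp: lookup_sum F in_keys_iff)
qed

lemma homog_independent:
  assumes "(\<Sum>M<n. F M) = 0" "\<And>M. F M \<in> homog M" "M < n"
  shows "F M = 0"
proof (rule poly_mapping_eqI)
  fix m
  have zero: "Poly_Mapping.lookup (F M) m = 0" if "tdeg m \<noteq> M" for M
    using assms(2)[of M] that by (auto simp: homog_def in_keys_iff)
  have "(\<Sum>M<n. Poly_Mapping.lookup (F M) m) = 0"
    using assms(1) by (simp flip: lookup_sum)
  moreover have "(\<Sum>M<n. Poly_Mapping.lookup (F M) m) = Poly_Mapping.lookup (F M) m" if "tdeg m = M"
    using assms(3) zero that by (subst sum.remove[of _ M]) (auto intro: sum.neutral)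
  ultimately show "Poly_Mapping.lookup (F M) m = Poly_Mapping.lookup 0 m"
    using zero[of M] by auto
qed

text \<open>This makes span induction and \<open>P.span_minimal\<close> available for (ii).\<close>

lemma sum_of_subspaces_eq_span:
  assumes "\<And>l. P.subspace (U l)"
  shows "sum_of_subspaces U = P.span (\<Union>l. U l)"
proof
  show "sum_of_subspaces U \<subseteq> P.span (\<Union>l. U l)"
    unfolding sum_of_subspaces_def by (auto intro!: P.span_sum) (blast intro: P.span_base)
  show "P.span (\<Union>l. U l) \<subseteq> sum_of_subspaces U"
  proof (rule P.span_minimal)
    show "(\<Union>l. U l) \<subseteq> sum_of_subspaces U"
    proof safe
      fix l f assume "f \<in> U l"
      then have "f = (\<Sum>k\<in>{l}. f) \<and> finite {l} \<and> (\<forall>k\<in>{l}. f \<in> U k)"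
        by simp
      then show "f \<in> sum_of_subspaces U"
        unfolding sum_of_subspaces_def mem_Collect_eq by (intro exI[of _ "{l}"] exI[of _ "\<lambda>_. f"])
    qed
    show "P.subspace (sum_of_subspaces U)"
    proof (rule P.subspaceI)
      show "0 \<in> sum_of_subspaces U"
        unfolding sum_of_subspaces_def by (auto intro!: exI[of _ "{}"])
    next
      fix f g assume "f \<in> sum_of_subspaces U" "g \<in> sum_of_subspaces U"
      then obtain S T a b where S: "finite S" "\<forall>l\<in>S. a l \<in> U l" "f = (\<Sum>l\<in>S. a l)"
        and T: "finite T" "\<forall>l\<in>T. b l \<in> U l" "g = (\<Sum>l\<in>T. b l)"
        unfolding sum_of_subspaces_def by blast
      \<comment> \<open>Both families are extended by 0 to the union of their index sets and added
        termwise.\<close>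
      define h where "h l = (if l \<in> S then a l else 0) + (if l \<in> T then b l else 0)" for l
      have "f + g = (\<Sum>l\<in>S \<union> T. h l)"
        using S(1) T(1)
        by (simp add: h_def S(3) T(3) sum.distrib sum.If_cases Int_absorb1 flip: sum.inter_restrict)
      moreover have "\<forall>l\<in>S \<union> T. h l \<in> U l"
        using S(2) T(2) assms by (auto simp: h_def intro: P.subspace_add P.subspace_0)
      ultimately show "f + g \<in> sum_of_subspaces U"
        using S(1) T(1) unfolding sum_of_subspaces_def by blast
    next
      fix c f assume "f \<in> sum_of_subspaces U"
      then obtain S a where "finite S" "\<forall>l\<in>S. a l \<in> U l" "f = (\<Sum>l\<in>S. a l)"
        unfolding sum_of_subspaces_def by blast
      then have "cscale c f = (\<Sum>l\<in>S. cscale c (a l))" "\<forall>l\<in>S. cscale c (a l) \<in> U l" "finite S"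
        using assms by (auto simp: P.scale_sum_right intro: P.subspace_scale)
      then show "cscale c f \<in> sum_of_subspaces U"
        unfolding sum_of_subspaces_def mem_Collect_eq
        by (intro exI[of _ S] exI[of _ "\<lambda>l. cscale c (a l)"]) auto
    qed
  qed
qed

section \<open>Eigenspaces of \<open>C\<^sub>i\<close>\<close>

lemma C_simps [simp]:
  "C i (f + g) = C i f + C i g" "C i (f - g) = C i f - C i g" "C i (cscale c f) = cscale c (C i f)"
  "C i 0 = 0"
  by (rule poly_mapping_eqI, simp only: C_def Omega2_def Omega_simps L_simps R_simps P.scale_zero_right
      L_zero R_zero lookup_cscale lookup_add lookup_minus, simp add: algebra_simps)+

lemma C_sum: "C i (\<Sum>k\<in>S. F k) = (\<Sum>k\<in>S. C i (F k))"
  by (induction S rule: infinite_finite_induct) simp_all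

lemma subspace_eigenspace_C: "P.subspace (eigenspace (C i) c)"
  by (rule P.subspaceI) (simp_all add: eigenspace_def P.scale_right_distrib P.scale_left_commute)

text \<open>Completing the square gives \<open>M * (M + 2) + 1 = (M + 1) ^ 2\<close>, and squaring
  is injective on the naturals.\<close>

lemma casimir_value_inj:
  "of_nat M * (of_nat M + 2) / 2 = (of_nat N * (of_nat N + 2) / 2 :: complex) \<longleftrightarrow> M = N"
proof
  assume "of_nat M * (of_nat M + 2) / 2 = (of_nat N * (of_nat N + 2) / 2 :: complex)"
  then have "of_nat (M * (M + 2)) = (of_nat (N * (N + 2)) :: complex)"
    by (simp only: of_nat_mult of_nat_add of_nat_numeral divide_cancel_right) simp
  then have "M * (M + 2) = N * (N + 2)"
    unfolding of_nat_eq_iff .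
  then have "(M + 1) ^ 2 = (N + 1) ^ 2"
    by (simp add: power2_eq_square algebra_simps)
  then show "M = N"
    by (simp add: power2_eq_iff)
qed simp

lemma subspace_R_funpow_image:
  "P.subspace ((R i ^^ l) ` ({f. L i f = 0} \<inter> homog N))"
proof -
  have K: "P.subspace ({f. L i f = 0} \<inter> homog N)"
    by (intro P.subspace_inter subspace_homog P.subspaceI) auto
  show ?thesis
  proof (induction l)
    case 0
    then show ?case using K by simp
  next
    case (Suc l)
    interpret R: Vector_Spaces.linear cscale cscale "R i"
      by unfold_locales simp_all
    show ?case
      using R.subspace_image[OF Suc] by (simp add: image_comp)
  qed
qed

lemma L_funpow_add: "(L i ^^ n) (f + g) = (L i ^^ n) f + (L i ^^ n) g"
  by (induction n) simp_all

lemma L_funpow_scale: "(L i ^^ n) (cscale c f) = cscale c ((L i ^^ n) f)"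
  by (induction n) simp_all

context
  fixes i :: nat
  assumes i: "i \<in> {1, 2, 3}"
begin

lemma LR_homog:
  assumes "f \<in> homog M"
  shows "L i (R i f) = R i (L i f) + cscale (of_nat M + 2) f"
  using comm_LR[OF i, of f] by (simp add: Omega_homog[OF assms] P.scale_left_distrib algebra_simps)

text \<open>By \<open>LR_homog\<close>, \<open>L R = R L + (M + 2) I\<close> in degree
  \<open>M\<close>; the scalars combine to
  \<open>(M + 2)^2 / 2 - (M + 2) = M (M + 2) / 2\<close>.\<close>

lemma C_homog:
  assumes "f \<in> homog M"
  shows "C i f = cscale (of_nat M * (of_nat M + 2) / 2) f - cscale 2 (R i (L i f))"
  by (rule poly_mapping_eqI)
    (simp only: C_def Omega2_def LR_homog[OF assms] Omega_homog[OF assms] Omega_simps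
      lookup_cscale lookup_add lookup_minus, simp add: field_simps)

lemma C_in_homog: "f \<in> homog M \<Longrightarrow> C i f \<in> homog M"
proof -
  assume f: "f \<in> homog M"
  have "R i (L i f) \<in> homog M"
  proof (cases "M < 2")
    case True
    then show ?thesis using L_eq_0[OF f] P.subspace_0[OF subspace_homog] by simp
  next
    case False
    then have "M - 2 + 2 = M" by simp
    then show ?thesis using R_homog[OF L_homog[OF f, of i], of i] by simp
  qed
  then show ?thesis
    unfolding C_homog[OF f] using f subspace_homog
    by (intro P.subspace_diff P.subspace_scale)
qed

text \<open>Passing from degree \<open>M\<close> to \<open>M + 2\<close> raises the scalar in
  \<open>C_homog\<close> by \<open>2 (M + 2)\<close>, which cancels the term produced by moving
  \<open>L\<close> past \<open>R\<close>.\<close>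

lemma C_R:
  assumes "f \<in> homog M"
  shows "C i (R i f) = R i (C i f)"
  unfolding C_homog[OF R_homog[OF assms]] C_homog[OF assms]
  by (rule poly_mapping_eqI)
    (simp only: LR_homog[OF assms] R_simps lookup_cscale lookup_add lookup_minus,
      simp add: field_simps)

text \<open>The cancellation is that of \<open>C_R\<close>, two degrees lower. For
  \<open>M < 2\<close> the cast of \<open>M - 2\<close> would be wrong, but both sides
  vanish.\<close>

lemma C_L:
  assumes "f \<in> homog M"
  shows "C i (L i f) = L i (C i f)"
proof (cases "M < 2")
  case True
  then show ?thesis
    using L_eq_0[OF assms] L_eq_0[OF C_in_homog[OF assms]] by simp
next
  case False
  then have M: "of_nat (M - 2) = (of_nat M - 2 :: complex)"
    by (simp add: of_nat_diff)
  show ?thesis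
    unfolding C_homog[OF L_homog[OF assms]] C_homog[OF assms] M
    by (rule poly_mapping_eqI)
      (simp only: LR_homog[OF L_homog[OF assms]] M L_simps lookup_cscale lookup_add lookup_minus,
        simp add: field_simps)
qed

lemma L_eigenspace_C:
  assumes "f \<in> homog M" "f \<in> eigenspace (C i) c"
  shows "L i f \<in> eigenspace (C i) c"
  using assms(2) by (simp add: eigenspace_def C_L[OF assms(1)])

text \<open>By induction \<open>L i f = 0\<close>, so \<open>C i\<close> acts on \<open>f\<close> by
  the scalar of degree \<open>M\<close>, which differs from that of \<open>N\<close>.\<close>

lemma eigenspace_C_below:
  assumes "f \<in> homog M" "f \<in> eigenspace (C i) (of_nat N * (of_nat N + 2) / 2)" "M < N"
  shows "f = 0"
  using assms
proof (induction M arbitrary: f rule: less_induct)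
  case (less M)
  have "L i f = 0"
  proof (cases "M < 2")
    case False
    then show ?thesis
      using less.IH[OF _ L_homog[OF less.prems(1)] L_eigenspace_C[OF less.prems(1,2)]] less.prems(3)
      by simp
  qed (use less.prems L_eq_0 in blast)
  then have "cscale (of_nat M * (of_nat M + 2) / 2) f = cscale (of_nat N * (of_nat N + 2) / 2) f"
    using less.prems(2) C_homog[OF less.prems(1)] by (simp add: eigenspace_def)
  then show ?case
    using less.prems(3) unfolding P.scale_cancel_right casimir_value_inj by simp
qed

lemma eigenspace_C_homog:
  assumes "f \<in> homog M" "f \<in> eigenspace (C i) (of_nat N * (of_nat N + 2) / 2)"
  shows "f \<in> P.span (\<Union>l. (R i ^^ l) ` ({f. L i f = 0} \<inter> homog N))" (is "_ \<in> P.span ?S")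
  using assms
proof (induction M arbitrary: f rule: less_induct)
  case (less M)
  show ?case
  proof (cases "M = N")
    case True
    have "L i f = 0"
    proof (cases "M < 2")
      case False
      then show ?thesis
        using eigenspace_C_below[OF L_homog[OF less.prems(1)] L_eigenspace_C[OF less.prems]] True
        by simp
    qed (use less.prems L_eq_0 in blast)
    then have "f \<in> (R i ^^ 0) ` ({f. L i f = 0} \<inter> homog N)"
      using less.prems True by simp
    then show ?thesis
      by (blast intro: P.span_base)
  next
    case False
    have "L i f \<in> P.span ?S"
    proof (cases "M < 2")
      case True
      then show ?thesis using L_eq_0[OF less.prems(1)] by (simp add: P.span_zero)
    next
      case False
      then show ?thesis
        using less.IH[OF _ L_homog[OF less.prems(1)] L_eigenspace_C[OF less.prems]] by simp
    qed
    \<comment> \<open>The span is stable under \<open>R i\<close>, which carries the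
      \<open>l\<close>-th image into the next one.\<close>
    then have RL: "R i (L i f) \<in> P.span ?S"
    proof (induction rule: P.span_induct_alt)
      case base
      then show ?case by (simp add: P.span_zero)
    next
      case (step c g h)
      then obtain l v where "L i v = 0" "v \<in> homog N" "g = (R i ^^ l) v"
        by blast
      then have "R i g \<in> (R i ^^ Suc l) ` ({f. L i f = 0} \<inter> homog N)"
        by auto
      then have "R i g \<in> P.span ?S"
        by (blast intro: P.span_base)
      then show ?case
        using step by (simp add: P.span_add P.span_scale)
    qed
    \<comment> \<open>By \<open>C_homog\<close>, the eigenvalue equation reads
      \<open>d f = 2 R L f\<close>; since \<open>d\<close> is nonzero, \<open>f\<close> can be
      recovered.\<close>
    define d :: complex where "d = of_nat M * (of_nat M + 2) / 2 - of_nat N * (of_nat N + 2) / 2"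
    have "d \<noteq> 0"
      using False casimir_value_inj by (simp add: d_def)
    moreover have "cscale d f = cscale 2 (R i (L i f))"
      using less.prems(2) C_homog[OF less.prems(1)]
      by (simp add: d_def eigenspace_def P.scale_left_diff_distrib algebra_simps)
    ultimately have "f = cscale (1 / d) (cscale 2 (R i (L i f)))"
      by (metis P.scale_scale P.scale_one nonzero_divide_eq_eq)
    then show ?thesis
      using RL by (metis P.span_scale)
  qed
qed

lemma R_funpow_eigenspace_C:
  assumes "v \<in> homog N" "L i v = 0"
  shows "(R i ^^ l) v \<in> eigenspace (C i) (of_nat N * (of_nat N + 2) / 2)"
proof (induction l)
  case 0
  then show ?case using C_homog[OF assms(1)] assms(2) by (simp add: eigenspace_def)
next
  case (Suc l)
  then show ?case
    using C_R[OF R_funpow_homog[OF assms(1), where i = i and l = l]] by (simp add: eigenspace_def)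
qed

lemma span_R_strings_eq_eigenspace_C:
  "P.span (\<Union>l. (R i ^^ l) ` ({f. L i f = 0} \<inter> homog N))
    = eigenspace (C i) (of_nat N * (of_nat N + 2) / 2)" (is "P.span ?S = eigenspace _ ?c")
proof
  show "P.span ?S \<subseteq> eigenspace (C i) ?c"
    using R_funpow_eigenspace_C by (intro P.span_minimal subspace_eigenspace_C) auto
  show "eigenspace (C i) ?c \<subseteq> P.span ?S"
  proof
    fix f assume f: "f \<in> eigenspace (C i) ?c"
    obtain F n where F: "f = (\<Sum>M<n. F M)" "\<And>M. F M \<in> homog M"
      by (rule homog_decomposition[of f]) blast
    have "F M \<in> P.span ?S" if "M < n" for M
    proof -
      \<comment> \<open>These summands are the homogeneous components of
        \<open>C i f - cscale ?c f = 0\<close>, so each of them vanishes.\<close>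
      have "(\<Sum>M<n. C i (F M) - cscale ?c (F M)) = 0"
        using f by (simp add: eigenspace_def F(1) C_sum P.scale_sum_right sum_subtractf)
      moreover have "C i (F M) - cscale ?c (F M) \<in> homog M" for M
        using F(2) C_in_homog subspace_homog by (blast intro: P.subspace_diff P.subspace_scale)
      ultimately have "C i (F M) - cscale ?c (F M) = 0"
        using \<open>M < n\<close> by (rule homog_independent)
      then show ?thesis
        using eigenspace_C_homog[OF F(2)] by (simp add: eigenspace_def)
    qed
    then show "f \<in> P.span ?S"
      unfolding F(1) by (auto intro: P.span_sum)
  qed
qed

section \<open>The submodule generated by a highest-weight vector\<close>

text \<open>Each passage of \<open>L\<close> across the \<open>R\<close> applied to
  \<open>R^j v\<close> contributes \<open>N + 2 j + 2\<close>; summing over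
  \<open>j = 0, ..., l\<close> gives the coefficient.\<close>

lemma L_R_funpow:
  assumes "v \<in> homog N" "L i v = 0"
  shows "L i ((R i ^^ Suc l) v) = cscale (of_nat (Suc l * (N + l + 2))) ((R i ^^ l) v)"
proof (induction l)
  case 0
  then show ?case using LR_homog[OF assms(1)] assms(2) by (simp add: add.commute)
next
  case (Suc l)
  have "L i ((R i ^^ Suc (Suc l)) v)
      = R i (L i ((R i ^^ Suc l) v)) + cscale (of_nat (N + 2 * Suc l) + 2) ((R i ^^ Suc l) v)"
    using LR_homog[OF R_funpow_homog[OF assms(1), where i = i and l = "Suc l"]] by simp
  also have "\<dots> = cscale (of_nat (Suc l * (N + l + 2)) + (of_nat (N + 2 * Suc l) + 2)) ((R i ^^ Suc l) v)"
    unfolding Suc by (simp only: R_simps P.scale_left_distrib funpow.simps o_apply)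
  also have "of_nat (Suc l * (N + l + 2)) + (of_nat (N + 2 * Suc l) + 2)
      = (of_nat (Suc (Suc l) * (N + Suc l + 2)) :: complex)"
    by (simp add: algebra_simps)
  finally show ?case .
qed

text \<open>The scalar is a product of coefficients from \<open>L_R_funpow\<close>, all of them
  positive integers.\<close>

lemma L_funpow_R_funpow:
  assumes "v \<in> homog N" "L i v = 0"
  shows "\<exists>d. d \<noteq> 0 \<and> (L i ^^ n) ((R i ^^ n) v) = cscale d v"
proof (induction n)
  case 0
  show ?case by (intro exI[of _ 1]) simp
next
  case (Suc n)
  then obtain d where d: "d \<noteq> 0" "(L i ^^ n) ((R i ^^ n) v) = cscale d v"
    by blast
  have "(L i ^^ Suc n) ((R i ^^ Suc n) v) = cscale (of_nat (Suc n * (N + n + 2)) * d) v"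
    unfolding funpow_Suc_right[of n "L i"] o_apply L_R_funpow[OF assms] L_funpow_scale d(2) by simp
  moreover have "of_nat (Suc n * (N + n + 2)) * d \<noteq> 0"
    unfolding mult_eq_0_iff of_nat_eq_0_iff using d(1) by simp
  ultimately show ?case by blast
qed

text \<open>After \<open>l\<close> steps a multiple of \<open>v\<close> is reached, and the next
  \<open>L\<close> kills it.\<close>

lemma L_funpow_string_eq_0:
  assumes "v \<in> homog N" "L i v = 0" "l < n"
  shows "(L i ^^ n) ((R i ^^ l) v) = 0"
proof -
  obtain k where n: "n = k + Suc l"
    using assms(3) by (metis add.commute less_imp_Suc_add add_Suc_right)
  obtain d where "(L i ^^ l) ((R i ^^ l) v) = cscale d v"
    using L_funpow_R_funpow[OF assms(1,2)] by blast
  then have "(L i ^^ Suc l) ((R i ^^ l) v) = 0"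
    using assms(2) by simp
  moreover have "(L i ^^ k) 0 = 0"
    by (induction k) simp_all
  ultimately show ?thesis
    unfolding n funpow_add by simp
qed

text \<open>Applying \<open>L^n\<close>, with \<open>n\<close> the top index occurring in
  \<open>u\<close>, kills all lower terms and leaves a nonzero multiple of \<open>v\<close>.\<close>

lemma generator_in_stable_subspace:
  assumes v: "v \<in> homog N" "L i v = 0"
    and U: "P.subspace U" "\<And>f. f \<in> U \<Longrightarrow> L i f \<in> U"
    and u: "u \<in> U" "u \<noteq> 0" "u \<in> P.span (range (\<lambda>l. (R i ^^ l) v))"
  shows "v \<in> U"
proof -
  have "v \<in> U" if "u \<in> P.span ((\<lambda>l. (R i ^^ l) v) ` {..<n})" for n
    using that
  proof (induction n)
    case 0
    then show ?case using u(2) by simp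
  next
    case (Suc n)
    let ?S = "(\<lambda>l. (R i ^^ l) v) ` {..<n}"
    \<comment> \<open>Here \<open>c\<close> is a coefficient of the top string vector; if it is 0, a
      shorter segment suffices.\<close>
    obtain c where c: "u - cscale c ((R i ^^ n) v) \<in> P.span ?S"
      using Suc.prems by (auto simp: lessThan_Suc P.span_breakdown_eq)
    show ?case
    proof (cases "c = 0")
      case True
      then show ?thesis using Suc.IH c by simp
    next
      case False
      have vanish: "(L i ^^ n) g = 0" if "g \<in> P.span ?S" for g
        using that
      proof (induction rule: P.span_induct_alt)
        case base
        show ?case by (induction n) simp_all
      next
        case (step c f g)
        then show ?case
          using L_funpow_string_eq_0[OF v] by (auto simp: L_funpow_add L_funpow_scale)
      qed
      obtain d where d: "d \<noteq> 0" "(L i ^^ n) ((R i ^^ n) v) = cscale d v"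
        using L_funpow_R_funpow[OF v] by blast
      have "(L i ^^ n) u = (L i ^^ n) (u - cscale c ((R i ^^ n) v))
          + (L i ^^ n) (cscale c ((R i ^^ n) v))"
        by (simp flip: L_funpow_add)
      also have "\<dots> = cscale (c * d) v"
        by (simp add: vanish[OF c] L_funpow_scale d(2))
      finally have "v = cscale (1 / (c * d)) ((L i ^^ n) u)"
        using False d(1) by simp
      moreover have "(L i ^^ n) u \<in> U"
        using u(1) U(2) by (induction n) simp_all
      ultimately show ?thesis
        using U(1) by (metis P.subspace_scale)
    qed
  qed
  \<comment> \<open>A span element involves finitely many string vectors, hence lies in the span of
    an initial segment.\<close>
  moreover obtain n where "u \<in> P.span ((\<lambda>l. (R i ^^ l) v) ` {..<n})"
  proof -
    obtain T where T: "finite T" "T \<subseteq> range (\<lambda>l. (R i ^^ l) v)" "u \<in> P.span T"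
      using u(3) unfolding P.span_explicit by (auto intro!: P.span_sum P.span_scale P.span_base)
    then obtain A where A: "finite A" "T = (\<lambda>l. (R i ^^ l) v) ` A"
      using finite_subset_image[OF T(1,2)] by auto
    obtain n where "A \<subseteq> {..<n}"
      using A(1) finite_nat_iff_bounded by blast
    then show ?thesis
      using that T(3) P.span_mono[OF image_mono, of A "{..<n}"] unfolding A(2) by blast
  qed
  ultimately show ?thesis by blast
qed

end

section \<open>Submodules in terms of the actions of \<open>E\<close>, \<open>F\<close>,
  \<open>H\<close>\<close>

lemma sl2_module_expand:
  assumes "sl2_module \<rho>" "A \<in> sl2"
  shows "\<rho> A f = cscale (A$1$2) (\<rho> matE f) + cscale (A$2$1) (\<rho> matF f) + cscale (A$1$1) (\<rho> matH f)"
proof -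
  let ?s = "\<lambda>c (B :: complex^2^2). \<chi> j. c *s B $ j"
  have mem: "matE \<in> sl2" "matF \<in> sl2" "matH \<in> sl2"
    by (simp_all add: sl2_def trace_def sum_2 matE_def matF_def matH_def)
  have scale: "?s c B \<in> sl2" if "B \<in> sl2" for c B
    using that by (simp add: sl2_def trace_def flip: sum_distrib_left)
  have add: "B + B' \<in> sl2" if "B \<in> sl2" "B' \<in> sl2" for B B'
    using that by (simp add: sl2_def trace_def sum.distrib)
  have "A$2$2 = - A$1$1"
    using assms(2) by (simp add: sl2_def trace_def sum_2 add_eq_0_iff)
  then have "A = ?s (A$1$2) matE + ?s (A$2$1) matF + ?s (A$1$1) matH"
    by (simp add: vec_eq_iff forall_2 matE_def matF_def matH_def)
  then have "\<rho> A f = \<rho> (?s (A$1$2) matE + ?s (A$2$1) matF + ?s (A$1$1) matH) f"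
    by simp
  then show ?thesis
    using assms(1) mem scale add unfolding sl2_module_def by simp
qed

lemma submodule_iff:
  assumes "sl2_module \<rho>"
  shows "submodule \<rho> W \<longleftrightarrow> P.subspace W \<and> (\<forall>f\<in>W. \<rho> matE f \<in> W \<and> \<rho> matF f \<in> W \<and> \<rho> matH f \<in> W)"
proof -
  have "matE \<in> sl2" "matF \<in> sl2" "matH \<in> sl2"
    by (simp_all add: sl2_def trace_def sum_2 matE_def matF_def matH_def)
  moreover have "\<rho> A f \<in> W"
    if W: "P.subspace W" "\<forall>f\<in>W. \<rho> matE f \<in> W \<and> \<rho> matF f \<in> W \<and> \<rho> matH f \<in> W"
      and "A \<in> sl2" "f \<in> W" for A f
    unfolding sl2_module_expand[OF assms \<open>A \<in> sl2\<close>]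
    using W \<open>f \<in> W\<close> by (intro P.subspace_add P.subspace_scale) blast+
  ultimately show ?thesis
    unfolding submodule_def by blast
qed

text \<open>A nonzero submodule contains \<open>v\<close> by
  \<open>generator_in_stable_subspace\<close>, and with \<open>v\<close> the whole string.\<close>

lemma irreducible_submodule_string:
  assumes i: "i \<in> {1, 2, 3}"
    and \<rho>: "sl2_module \<rho>" "\<rho> matE = (\<lambda>f. - L i f)" "\<rho> matF = R i"
      "\<rho> matH = (\<lambda>f. - Omega f - cscale 2 f)"
    and v: "v \<in> homog N" "L i v = 0" "v \<noteq> 0"
  shows "irreducible_submodule \<rho> (P.span (range (\<lambda>l. (R i ^^ l) v)))"
    (is "irreducible_submodule \<rho> (P.span ?S)")
proof -
  have "v \<in> ?S"
    by (rule image_eqI[of _ _ 0]) simp_all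
  then have vW: "v \<in> P.span ?S"
    by (rule P.span_base)
  have RS: "R i f \<in> ?S" if f: "f \<in> ?S" for f
  proof -
    from f obtain l where "f = (R i ^^ l) v" by blast
    then show ?thesis by (intro image_eqI[of _ _ "Suc l"]) simp_all
  qed
  have LS: "L i f \<in> P.span ?S" if f: "f \<in> ?S" for f
  proof -
    from f obtain l where l: "f = (R i ^^ l) v" by blast
    show ?thesis
    proof (cases l)
      case 0
      then show ?thesis using l v by (simp add: P.span_zero)
    next
      case (Suc k)
      show ?thesis
        unfolding l Suc L_R_funpow[OF i v(1,2)] by (intro P.span_scale P.span_base) blast
    qed
  qed
  have OS: "Omega f \<in> P.span ?S" if f: "f \<in> ?S" for f
  proof -
    from f obtain l where l: "f = (R i ^^ l) v" by blast
    show ?thesis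
      using f unfolding l Omega_homog[OF R_funpow_homog[OF v(1)]]
      by (intro P.span_scale P.span_base)
  qed
  have stable: "L i f \<in> P.span ?S \<and> R i f \<in> P.span ?S \<and> Omega f \<in> P.span ?S"
    if "f \<in> P.span ?S" for f
    using that
  proof (induction rule: P.span_induct_alt)
    case base
    show ?case by (simp add: P.span_zero)
  next
    case (step c g h)
    then show ?case
      using LS[of g] OS[of g] P.span_base[OF RS[of g]] by (simp add: P.span_add P.span_scale)
  qed
  have "submodule \<rho> (P.span ?S)"
    unfolding submodule_iff[OF \<rho>(1)] \<rho>(2-4) using stable
    by (auto intro: P.span_neg P.span_diff P.span_scale)
  moreover have "P.span ?S \<noteq> {0}"
    using vW v(3) by blast
  moreover have "U = {0} \<or> U = P.span ?S" if U: "submodule \<rho> U" "U \<subseteq> P.span ?S" for U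
  proof (cases "U = {0}")
    case False
    have sub: "P.subspace U" and E: "\<And>f. f \<in> U \<Longrightarrow> - L i f \<in> U" and F: "\<And>f. f \<in> U \<Longrightarrow> R i f \<in> U"
      using U(1) unfolding submodule_iff[OF \<rho>(1)] \<rho>(2-4) by auto
    obtain u where u: "u \<in> U" "u \<noteq> 0"
      using False P.subspace_0[OF sub] by blast
    have "v \<in> U"
    proof (rule generator_in_stable_subspace[OF i v(1,2) sub _ u])
      show "L i f \<in> U" if "f \<in> U" for f
        using P.subspace_neg[OF sub E[OF that]] by simp
      show "u \<in> P.span ?S"
        using u(1) U(2) by blast
    qed
    then have "(R i ^^ l) v \<in> U" for l
      by (induction l) (simp_all add: F)
    then have "P.span ?S \<subseteq> U"
      using sub by (intro P.span_minimal) auto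
    then show ?thesis
      using U(2) by blast
  qed simp
  ultimately show ?thesis
    unfolding irreducible_submodule_def by blast
qed

theorem lemma13p15:
  fixes i N :: nat and \<rho> :: "complex^2^2 \<Rightarrow> P \<Rightarrow> P"
  assumes "i \<in> {1, 2, 3}"
    and "sl2_module \<rho>"
    and "\<rho> matE = (\<lambda>f. - L i f)"
    and "\<rho> matF = R i"
    and "\<rho> matH = (\<lambda>f. - Omega f - cscale 2 f)"
  shows "P.span (\<Union>{W. irreducible_submodule \<rho> W \<and> has_highest_weight \<rho> W (- of_nat N - 2)})
           = sum_of_subspaces (\<lambda>l. (R i ^^ l) ` ({f. L i f = 0} \<inter> homog N))
         \<and> sum_of_subspaces (\<lambda>l. (R i ^^ l) ` ({f. L i f = 0} \<inter> homog N))
           = eigenspace (C i) (of_nat N * (of_nat N + 2) / 2)"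
proof -
  let ?K = "{f. L i f = 0} \<inter> homog N"
  let ?S = "\<Union>l. (R i ^^ l) ` ?K"
  let ?I = "{W. irreducible_submodule \<rho> W \<and> has_highest_weight \<rho> W (- of_nat N - 2)}"
  \<comment> \<open>Since \<open>H\<close> acts as \<open>- Omega - 2 I\<close>, weight
    \<open>- N - 2\<close> means degree \<open>N\<close>.\<close>
  have weight: "\<rho> matH v = cscale (- of_nat N - 2) v \<longleftrightarrow> v \<in> homog N" for v
    unfolding assms(5) homog_iff_Omega
    by (simp add: P.scale_left_diff_distrib)
  have sum: "sum_of_subspaces (\<lambda>l. (R i ^^ l) ` ?K) = P.span ?S"
    by (intro sum_of_subspaces_eq_span subspace_R_funpow_image)
  have "P.span (\<Union>?I) = P.span ?S"
  proof (intro equalityI P.span_minimal P.subspace_span)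
    show "\<Union>?I \<subseteq> P.span ?S"
    proof (rule Union_least)
      fix W assume "W \<in> ?I"
      then obtain v where "\<rho> matH v = cscale (- of_nat N - 2) v" "\<rho> matE v = 0"
        and W: "W = P.span (range (\<lambda>l. (\<rho> matF ^^ l) v))"
        unfolding has_highest_weight_def by blast
      then have "v \<in> ?K"
        by (simp add: weight assms(3))
      then show "W \<subseteq> P.span ?S"
        unfolding W assms(4) by (intro P.span_mono) auto
    qed
    show "?S \<subseteq> P.span (\<Union>?I)"
    proof safe
      fix l v assume v: "L i v = 0" "v \<in> homog N"
      show "(R i ^^ l) v \<in> P.span (\<Union>?I)"
      proof (cases "v = 0")
        case True
        have "(R i ^^ l) 0 = 0"
          by (induction l) simp_all
        then show ?thesis using True by (simp add: P.span_zero)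
      next
        case False
        \<comment> \<open>Each nonzero \<open>v\<close> in \<open>?K\<close> is a highest-weight
          vector of the irreducible submodule that its own string spans.\<close>
        define W where "W = P.span (range (\<lambda>l. (R i ^^ l) v))"
        have W: "(R i ^^ l) v \<in> W" for l
          unfolding W_def by (intro P.span_base) blast
        have "irreducible_submodule \<rho> W"
          unfolding W_def using irreducible_submodule_string assms v False by blast
        moreover have "has_highest_weight \<rho> W (- of_nat N - 2)"
          unfolding has_highest_weight_def
          using W[of 0] False v weight[of v] by (intro bexI[of _ v]) (simp_all add: assms(3,4) W_def)
        ultimately show ?thesis
          using W by (blast intro: P.span_base)
      qed
    qed
  qed
  then show ?thesis
    unfolding sum using span_R_strings_eq_eigenspace_C[OF assms(1)] by blast
qed

end
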